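(* Let $q$ be a prime power and let $n\ge 1$ and $r>2$ be integers. Let $\mathcal{S}$ be an $(n-1)$-spread of $\mathrm{PG}(rn-1,q)$ having $r$ normal elements in general position. Then $\mathcal{S}$ is projectively equivalent (i.e. equivalent under a collineation of $\mathrm{PG}(rn-1,q)$) to $\mathcal{S}_r(\mathbf{M})$ for some nearfield spread set $\mathbf{M}$.
   Context: An $(n-1)$-spread of $\mathrm{PG}(N-1,q)$ is a set of $(n-1)$-dimensional projective subspaces partitioning the point set. An element $E$ of an $(n-1)$-spread $\mathcal{S}$ of $\mathrm{PG}(rn-1,q)$ is a normal element if for every $F\in\mathcal{S}$, $F\neq E$, the $(2n-1)$-dimensional subspace $\langle E,F\rangle$ is partitioned by elements of $\mathcal{S}$. A set of $(n-1)$-spaces of $\mathrm{PG}(kn-1,q)$ is in general position if any $k$ of them span the whole space. Coordinates: points of $\mathrm{PG}(rn-1,q)$ are written $(x_1,\dots,x_r)_{\mathbb{F}_q}$ with $x_i\in\mathbb{F}_q^n$ (row vectors), not all zero, up to nonzero $\mathbb{F}_q$-scalars. For $n\times n$ matrices $A_1,\dots,A_r$ over $\mathbb{F}_q$ such that the $n\times rn$ matrix $[A_1\ \cdots\ A_r]$ has rank $n$, $(A_1,\dots,A_r)$ denotes the $(n-1)$-space $\{(xA_1,\dots,xA_r)_{\mathbb{F}_q}: x\in\mathbb{F}_q^n\setminus\{0\}\}$; $I$ and $0$ denote the identity and zero $n\times n$ matrices. A spread set is a set $\mathbf{M}$ of $q^n$ matrices of size $n\times n$ over $\mathbb{F}_q$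 such that $A-B$ is nonsingular for all distinct $A,B\in\mathbf{M}$. A nearfield spread set is a spread set containing $0$ and $I$ that is closed under matrix multiplication. For a spread set $\mathbf{M}$ containing $0$ and $I$, $\mathcal{S}_r(\mathbf{M})$ is the set of $(n-1)$-spaces $(A_1,\dots,A_r)$ with all $A_i\in\mathbf{M}$, not all $A_i$ zero, and such that the first nonzero $A_k$ equals $I$. *)

theory Defs
  imports "HOL-Analysis.Analysis" "HOL-Library.Disjoint_Sets"
begin

text \<open>
  \<open>PG(N-1,q)\<close> is the projective geometry of the vector space \<open>'a ^ 'm\<close>, where \<open>'a\<close> is a finite
  field, \<open>q = CARD('a)\<close> and \<open>N = CARD('m)\<close>. A point is a one-dimensional vector subspace, and a
  projective subspace is the set of the points it contains.
\<close>

definition pg_point :: "'a::field ^ 'm \<Rightarrow> ('a ^ 'm) set" where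
  "pg_point v = vec.span {v}"

definition points_of :: "('a::field ^ 'm) set \<Rightarrow> ('a ^ 'm) set set" where
  "points_of U = pg_point ` (U - {0})"

definition pg_points :: "('a::field ^ 'm) set set" where
  "pg_points = points_of UNIV"

text \<open>The argument is the projective dimension, one less than the vector space dimension.\<close>

definition pg_subspaces :: "nat \<Rightarrow> ('a::field ^ 'm) set set set" where
  "pg_subspaces d = {points_of U | U. vec.subspace U \<and> vec.dim U = d + 1}"

definition pg_span :: "('a::field ^ 'm) set set \<Rightarrow> ('a ^ 'm) set set" where
  "pg_span X = points_of (vec.span (\<Union>X))"

definition collineation :: "(('a::field ^ 'm) set \<Rightarrow> ('a ^ 'm) set) \<Rightarrow> bool" where
  "collineation f \<longleftrightarrow>
     bij_betw f pg_points pg_points \<and>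
     bij_betw (image f) (pg_subspaces 1) (pg_subspaces 1)"

definition projectively_equivalent ::
    "('a::field ^ 'm) set set set \<Rightarrow> ('a ^ 'm) set set set \<Rightarrow> bool" where
  "projectively_equivalent S T \<longleftrightarrow> (\<exists>f. collineation f \<and> image f ` S = T)"

definition is_spread :: "nat \<Rightarrow> ('a::field ^ 'm) set set set \<Rightarrow> bool" where
  "is_spread d S \<longleftrightarrow> S \<subseteq> pg_subspaces d \<and> partition_on pg_points S"

definition normal_element ::
    "('a::field ^ 'm) set set set \<Rightarrow> ('a ^ 'm) set set \<Rightarrow> bool" where
  "normal_element S E \<longleftrightarrow>
     E \<in> S \<and> (\<forall>F\<in>S. F \<noteq> E \<longrightarrow> (\<exists>T\<subseteq>S. partition_on (pg_span (E \<union> F)) T))"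

text \<open>
  From here on the coordinates are split into blocks: with \<open>r = CARD('r)\<close> and \<open>n = CARD('n)\<close>, the
  vector \<open>(x\<^sub>1, \<dots>, x\<^sub>r)\<close> with \<open>x\<^sub>i \<in> 'a ^ 'n\<close> is an element of \<open>'a ^ ('r \<times> 'n)\<close>, whose
  component \<open>(i, j)\<close> is the \<open>j\<close>-th component of \<open>x\<^sub>i\<close>.
\<close>

definition general_position :: "('a::field ^ ('k::finite \<times> 'n::finite)) set set set \<Rightarrow> bool" where
  "general_position X \<longleftrightarrow>
     X \<subseteq> pg_subspaces (CARD('n) - 1) \<and>
     (\<forall>K\<subseteq>X. card K = CARD('k) \<longrightarrow> pg_span (\<Union>K) = pg_points)"

definition block_vector :: "('r \<Rightarrow> 'a ^ 'n) \<Rightarrow> 'a ^ ('r::finite \<times> 'n::finite)" where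
  "block_vector x = (\<chi> p. x (fst p) $ snd p)"

text \<open>
  The space \<open>(A\<^sub>1, \<dots>, A\<^sub>r)\<close>. It is \<open>(n-1)\<close>-dimensional only if \<open>[A\<^sub>1 \<dots> A\<^sub>r]\<close> has rank \<open>n\<close>, which
  holds whenever some \<open>A\<^sub>i\<close> is the identity, as it is wherever this is used below.
\<close>

definition matrix_space ::
    "('r \<Rightarrow> 'a ^ 'n ^ 'n) \<Rightarrow> ('a::field ^ ('r::finite \<times> 'n::finite)) set set" where
  "matrix_space A = {pg_point (block_vector (\<lambda>i. x v* A i)) | x. x \<noteq> 0}"

definition spread_set :: "('a::{field,finite} ^ 'n ^ 'n::finite) set \<Rightarrow> bool" where
  "spread_set M \<longleftrightarrow>
     card M = CARD('a) ^ CARD('n) \<and>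
     (\<forall>A\<in>M. \<forall>B\<in>M. A \<noteq> B \<longrightarrow> invertible (A - B))"

definition nearfield_spread_set :: "('a::{field,finite} ^ 'n ^ 'n::finite) set \<Rightarrow> bool" where
  "nearfield_spread_set M \<longleftrightarrow>
     spread_set M \<and> 0 \<in> M \<and> mat 1 \<in> M \<and> (\<forall>A\<in>M. \<forall>B\<in>M. A ** B \<in> M)"

text \<open>
  \<open>\<S>\<^sub>r(M)\<close>, with \<open>r = CARD('r)\<close> determined by the result type. The linear order on \<open>'r\<close> gives
  meaning to the first nonzero entry.
\<close>

definition spread_of ::
    "('a::field ^ 'n ^ 'n) set \<Rightarrow> ('a ^ ('r::{finite,linorder} \<times> 'n::finite)) set set set" where
  "spread_of M =
     {matrix_space A | A. (\<forall>i. A i \<in> M) \<and> (\<exists>i. A i \<noteq> 0) \<and>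
        (\<forall>k. A k \<noteq> 0 \<and> (\<forall>i<k. A i = 0) \<longrightarrow> A k = mat 1)}"

end

theory Submission
  imports Defs
begin

text \<open>
  Choose coordinates in which the normal elements are the \<open>r\<close> coordinate axes. Normality makes every
  coordinate subspace a union of spread elements, and replacing a block of a spread element by zero
  gives a spread element again. Hence a spread element is \<open>(A\<^sub>1, \<dots>, A\<^sub>r)\<close> with some \<open>A\<^sub>i = I\<close>, the
  spread is determined by the sets \<open>M\<^sub>i\<^sub>j\<close> of matrices \<open>A\<^sub>j\<close> occurring next to \<open>A\<^sub>i = I\<close>, and all
  combinations of such matrices occur. Rescaling the axes puts \<open>(I, \<dots>, I)\<close> into the spread. For
  distinct \<open>i, j, k\<close>, dividing \<open>(I, A, B)\<close> by \<open>A\<close> shows \<open>A\<^sup>-\<^sup>1 B \<in> M\<^sub>j\<^sub>k\<close> for nonzero \<open>A \<in> M\<^sub>i\<^sub>j\<close> and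
  \<open>B \<in> M\<^sub>i\<^sub>k\<close>; with \<open>r \<ge> 3\<close> this forces all \<open>M\<^sub>i\<^sub>j\<close> to coincide and to be closed under products.
\<close>

section \<open>Blocks of vectors, coordinate axes and row spaces of matrices\<close>

definition block :: "'a ^ ('r::finite \<times> 'n::finite) \<Rightarrow> 'r \<Rightarrow> 'a ^ 'n" where
  "block v i = (\<chi> j. v $ (i, j))"

lemma block_block_vector [simp]: "block (block_vector x) i = x i"
  by (simp add: block_def block_vector_def vec_eq_iff)

lemma block_vector_block [simp]: "block_vector (block v) = v"
  by (simp add: block_def block_vector_def vec_eq_iff)

lemma block_eq_iff: "v = w \<longleftrightarrow> (\<forall>i. block v i = block w i)"
  by (auto simp: block_def vec_eq_iff)

lemma block_zero [simp]: "block 0 i = 0"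
  by (simp add: block_def vec_eq_iff)

lemma block_add [simp]: "block (v + w) i = block v i + block w i"
  by (simp add: block_def vec_eq_iff)

lemma block_diff [simp]: "block (v - w) i = block v i - block w i"
  for v w :: "'a::ab_group_add ^ ('r::finite \<times> 'n::finite)"
  by (simp add: block_def vec_eq_iff)

lemma block_scale [simp]: "block (c *s v) i = c *s block v i"
  by (simp add: block_def vec_eq_iff)

lemma linearI:
  fixes f :: "'a::field ^ 'm \<Rightarrow> 'a ^ 'k"
  assumes "\<And>v w. f (v + w) = f v + f w" and "\<And>c v. f (c *s v) = c *s f v"
  shows "Vector_Spaces.linear (*s) (*s) f"
  using assms by (simp add: Vector_Spaces.linear_iff vec.vector_space_axioms)

lemma linear_block: "Vector_Spaces.linear (*s) (*s) (\<lambda>v. block v i)"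
  by (rule linearI) simp_all

definition axis_space :: "'r \<Rightarrow> ('a::field ^ ('r::finite \<times> 'n::finite)) set" where
  "axis_space i = {v. \<forall>j. j \<noteq> i \<longrightarrow> block v j = 0}"

definition drop_block :: "'r \<Rightarrow> 'a::field ^ ('r::finite \<times> 'n::finite) \<Rightarrow> 'a ^ ('r \<times> 'n)" where
  "drop_block i v = block_vector ((block v)(i := 0))"

lemma block_drop_block [simp]: "block (drop_block i v) j = (if j = i then 0 else block v j)"
  by (simp add: drop_block_def)

lemma drop_block_zero_iff: "drop_block i v = 0 \<longleftrightarrow> v \<in> axis_space i"
  by (auto simp: block_eq_iff axis_space_def)

lemma diff_drop_block: "v - drop_block i v \<in> axis_space i"
  by (auto simp: axis_space_def)

lemma subspace_axis_space: "vec.subspace (axis_space i)"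
  by (auto simp: vec.subspace_def axis_space_def)

text \<open>The vector space behind \<open>matrix_space A\<close>, zero vector included, so that
  linear algebra applies directly.\<close>

definition row_space :: "('r \<Rightarrow> 'a ^ 'n ^ 'n) \<Rightarrow> ('a::field ^ ('r::finite \<times> 'n::finite)) set" where
  "row_space A = range (\<lambda>x. block_vector (\<lambda>i. x v* A i))"

text \<open>Block \<open>i\<close> of a vector in the space is its parameter \<open>x\<close>, so
  the space is a graph over that block and fixes all the others.\<close>

lemma row_space_inj:
  assumes "row_space A = row_space B" and "A i = mat 1" and "B i = mat 1"
  shows "A = B"
proof
  fix j
  have "x v* A j = x v* B j" for x
  proof -
    have "block_vector (\<lambda>i. x v* A i) \<in> row_space B"
      using assms(1) by (auto simp: row_space_def)
    then obtain y where y: "block_vector (\<lambda>i. x v* A i) = block_vector (\<lambda>i. y v* B i)"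
      by (auto simp: row_space_def)
    have eq: "x v* A k = y v* B k" for k
      using arg_cong[OF y, of "\<lambda>v. block v k"] by simp
    have "x = y" using eq[of i] assms by simp
    then show ?thesis using eq by simp
  qed
  \<comment> \<open>\<open>matrix_eq\<close> tests matrices on column vectors, hence the
    transposes.\<close>
  then have "transpose (A j) *v x = transpose (B j) *v x" for x by simp
  then have "transpose (A j) = transpose (B j)" by (simp add: matrix_eq)
  then show "A j = B j" by (metis transpose_transpose)
qed

text \<open>Left multiplication by an invertible \<open>B\<close> only reparametrizes the space,
  through the bijection \<open>x \<mapsto> x v* B\<close>.\<close>

lemma row_space_scale:
  fixes A :: "'r::finite \<Rightarrow> 'a::field ^ 'n ^ 'n::finite"
  assumes "invertible B"
  shows "row_space (\<lambda>i. B ** A i) = row_space A"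
proof -
  obtain C where C: "C ** B = mat 1" using assms by (auto simp: invertible_def)
  have "(x v* C) v* B = x" for x
    by (simp only: vector_matrix_mul_assoc C vector_matrix_mul_rid)
  then have "range (\<lambda>x. x v* B) = UNIV" by (rule surjI)
  then have "row_space A = (\<lambda>x. block_vector (\<lambda>i. x v* A i)) ` range (\<lambda>x. x v* B)"
    by (simp add: row_space_def)
  then show ?thesis by (simp add: row_space_def image_image vector_matrix_mul_assoc)
qed

lemma row_space_drop:
  "drop_block i ` row_space A = row_space (A(i := 0))"
proof -
  have "drop_block i (block_vector (\<lambda>j. x v* A j)) = block_vector (\<lambda>j. x v* (A(i := 0)) j)" for x
    by (simp add: block_eq_iff)
  then show ?thesis by (simp add: row_space_def image_image)
qed

lemma row_space_axis: "row_space (\<lambda>j. if j = i then mat 1 else 0) = axis_space i"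
proof -
  have "v = block_vector (\<lambda>j. block v i v* (if j = i then mat 1 else 0))" 
    if "v \<in> axis_space i" for v :: "'a ^ ('b \<times> 'c)"
    using that by (auto simp: block_eq_iff axis_space_def)
  then show ?thesis by (auto simp: row_space_def axis_space_def)
qed

section \<open>Spreads as families of vector subspaces, and spreads whose coordinate axes are all
  normal\<close>

definition vector_spread :: "nat \<Rightarrow> ('a::field ^ 'm) set set \<Rightarrow> bool" where
  "vector_spread d \<Sigma> \<longleftrightarrow>
     (\<forall>U\<in>\<Sigma>. vec.subspace U \<and> vec.dim U = d) \<and> (\<forall>v. v \<noteq> 0 \<longrightarrow> (\<exists>!U. U \<in> \<Sigma> \<and> v \<in> U))"

text \<open>Expresses the partition of the span without naming its parts. Allowing
  \<open>F = E\<close> is harmless, since distinct elements of a spread meet only in zero.\<close>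

definition normal_subspace :: "('a::field ^ 'm) set set \<Rightarrow> ('a ^ 'm) set \<Rightarrow> bool" where
  "normal_subspace \<Sigma> E \<longleftrightarrow> E \<in> \<Sigma> \<and>
     (\<forall>F\<in>\<Sigma>. \<forall>U\<in>\<Sigma>. U \<inter> vec.span (E \<union> F) \<subseteq> {0} \<or> U \<subseteq> vec.span (E \<union> F))"

locale axis_normal_spread =
  fixes \<Sigma> :: "('a::field ^ ('r::finite \<times> 'n::finite)) set set"
  assumes spread: "vector_spread CARD('n) \<Sigma>"
    and normal_axis: "normal_subspace \<Sigma> (axis_space i)"
begin

lemma subspace: "U \<in> \<Sigma> \<Longrightarrow> vec.subspace U"
  using spread by (simp add: vector_spread_def)

lemma dim: "U \<in> \<Sigma> \<Longrightarrow> vec.dim U = CARD('n)"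
  using spread by (simp add: vector_spread_def)

lemma axis_in: "axis_space i \<in> \<Sigma>"
  using normal_axis by (simp add: normal_subspace_def)

lemma covers: obtains U where "U \<in> \<Sigma>" "v \<in> U"
proof (cases "v = 0")
  case True
  then show ?thesis using that[OF axis_in] subspace[OF axis_in] vec.subspace_0 by blast
next
  case False
  then show ?thesis using spread that by (auto simp: vector_spread_def)
qed

lemma unique: "\<lbrakk>U \<in> \<Sigma>; W \<in> \<Sigma>; v \<in> U; v \<in> W; v \<noteq> 0\<rbrakk> \<Longrightarrow> U = W"
  using spread by (auto simp: vector_spread_def)

lemma has_nonzero:
  assumes "U \<in> \<Sigma>"
  obtains v where "v \<in> U" "v \<noteq> 0"
proof -
  have "\<not> U \<subseteq> {0}"
    using dim[OF assms] by (metis vec.dim_eq_0 zero_less_card_finite less_irrefl)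
  then show ?thesis using that by auto
qed

text \<open>Normality of an axis in the form used below: one nonzero vector of \<open>U\<close> in
  the sum of the axis and \<open>F\<close> forces all of \<open>U\<close> into that sum.\<close>

lemma axis_sum:
  assumes "F \<in> \<Sigma>" "U \<in> \<Sigma>" "w \<in> U" "w \<noteq> 0" "a \<in> axis_space i" "b \<in> F" "w = a + b" "u \<in> U"
  obtains a' b' where "a' \<in> axis_space i" "b' \<in> F" "u = a' + b'"
proof -
  have sp: "vec.span (axis_space i \<union> F) = {x + y |x y. x \<in> axis_space i \<and> y \<in> F}"
    by (simp add: vec.span_Un vec.span_eq_iff[THEN iffD2] subspace_axis_space subspace[OF assms(1)])
  then have "w \<in> vec.span (axis_space i \<union> F)" using assms by auto
  then have "U \<subseteq> vec.span (axis_space i \<union> F)"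
    using normal_axis[of i] assms unfolding normal_subspace_def by blast
  then show ?thesis using assms(8) sp that by auto
qed

text \<open>
  Induction on the support: every subspace \<open>{v. supp v \<subseteq> J}\<close> is partitioned by the spread, since
  adjoining one more axis means passing to spans with a normal element.
\<close>

lemma support_aux:
  assumes "finite J"
  shows "\<lbrakk>U \<in> \<Sigma>; u \<in> U; u \<noteq> 0; \<And>i. i \<notin> J \<Longrightarrow> block u i = 0; v \<in> U; i \<notin> J\<rbrakk> \<Longrightarrow> block v i = 0"
  using assms
proof (induction J arbitrary: U u v i rule: finite_induct)
  case empty
  then show ?case by (simp add: block_eq_iff)
next
  case (insert j J)
  show ?case
  proof (cases "drop_block j u = 0")
    case True
    then have "u \<in> axis_space j" by (simp add: drop_block_zero_iff)
    then have "U = axis_space j" using unique axis_in insert.prems by blast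
    then show ?thesis using insert.prems by (auto simp: axis_space_def)
  next
    case False
    \<comment> \<open>\<open>u\<close> is its projection plus a vector of axis \<open>j\<close>, so
      normality puts all of \<open>U\<close> into the sum of that axis and \<open>G\<close>. The
      induction hypothesis applies to \<open>G\<close>, because \<open>drop_block j u\<close> has
      support in \<open>J\<close>.\<close>
    obtain G where G: "G \<in> \<Sigma>" "drop_block j u \<in> G" by (rule covers)
    obtain a b where ab: "a \<in> axis_space j" "b \<in> G" "v = a + b"
      using axis_sum[OF G(1) insert.prems(1-3) diff_drop_block G(2) _ insert.prems(5)]
      by (metis diff_add_cancel)
    have "block b i = 0"
      using insert.IH[OF G False _ ab(2)] insert.prems(4,6) by auto
    then show ?thesis using ab insert.prems(6) by (auto simp: axis_space_def)
  qed
qed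

text \<open>The support of \<open>u\<close> serves as the set \<open>J\<close>. Hence all nonzero
  vectors of a spread element have the same support, and each block map is either zero or injective
  on the element.\<close>

lemma support:
  assumes "U \<in> \<Sigma>" "u \<in> U" "u \<noteq> 0" "block u i = 0" "v \<in> U"
  shows "block v i = 0"
  by (rule support_aux[where J = "{j. block u j \<noteq> 0}" and U = U and u = u]) (use assms in auto)

text \<open>Let \<open>G\<close> be the spread element through one projected vector. Normality puts
  \<open>U\<close> into axis plus \<open>G\<close> and \<open>G\<close> into axis plus
  \<open>U\<close>. As \<open>G\<close> has zero block \<open>i\<close> by \<open>support\<close>,
  the projection of \<open>U\<close> is exactly \<open>G\<close>.\<close>

lemma drop_block_in:
  assumes U: "U \<in> \<Sigma>" and ne: "U \<noteq> axis_space i"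
  shows "drop_block i ` U \<in> \<Sigma>"
proof -
  obtain u where u: "u \<in> U" "u \<noteq> 0" using has_nonzero[OF U] .
  have nz: "drop_block i u \<noteq> 0"
    using ne u unique[OF U axis_in] by (auto simp: drop_block_zero_iff)
  obtain G where G: "G \<in> \<Sigma>" "drop_block i u \<in> G" by (rule covers)
  have Gi: "block g i = 0" if "g \<in> G" for g
    using support[OF G nz _ that] by simp
  have "drop_block i ` U \<subseteq> G"
  proof (clarify)
    fix v assume v: "v \<in> U"
    obtain a b where ab: "a \<in> axis_space i" "b \<in> G" "v = a + b"
      using axis_sum[OF G(1) U u diff_drop_block G(2) _ v] by (metis diff_add_cancel)
    then have "drop_block i v = b" using Gi[OF ab(2)] by (auto simp: block_eq_iff axis_space_def)
    then show "drop_block i v \<in> G" using ab by simp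
  qed
  moreover have "G \<subseteq> drop_block i ` U"
  proof
    fix g assume g: "g \<in> G"
    have neg: "drop_block i u - u \<in> axis_space i" by (simp add: axis_space_def)
    obtain a b where ab: "a \<in> axis_space i" "b \<in> U" "g = a + b"
      using axis_sum[OF U G nz neg u(1) _ g] by (metis diff_add_cancel)
    then have "g = drop_block i b" using Gi[OF g] by (auto simp: block_eq_iff axis_space_def)
    then show "g \<in> drop_block i ` U" using ab(2) by (rule image_eqI)
  qed
  ultimately show ?thesis using G by simp
qed

text \<open>By \<open>support\<close>, block \<open>i\<close> is injective on \<open>U\<close>.
  Since \<open>U\<close> has dimension \<open>n\<close>, this block map is an isomorphism onto the
  space of row vectors, and the other blocks are linear functions of block \<open>i\<close>.\<close>

lemma row_space_exists:
  assumes U: "U \<in> \<Sigma>" and u: "u \<in> U" "block u i \<noteq> 0"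
  obtains A where "U = row_space A" "A i = mat 1"
proof -
  have "\<exists>g :: 'a ^ 'n \<Rightarrow> 'a ^ ('r \<times> 'n). Vector_Spaces.linear (*s) (*s) g \<and> g ` UNIV = U \<and> inj_on g UNIV"
    by (rule vec.subspace_isomorphism[OF vec.subspace_UNIV subspace[OF U]])
      (simp add: dim[OF U] card_cart_basis)
  then obtain g :: "'a ^ 'n \<Rightarrow> 'a ^ ('r \<times> 'n)"
    where g: "Vector_Spaces.linear (*s) (*s) g" "range g = U" "inj g" by auto
  let ?h = "\<lambda>x. block (g x) i"
  have lin: "Vector_Spaces.linear (*s) (*s) (\<lambda>x. block (g x) j)" for j
    using Vector_Spaces.linear_compose[OF g(1) linear_block] by (simp add: o_def)
  have "x = 0" if "?h x = 0" for x
  proof -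
    have "g x = 0" using support[OF U _ _ that u(1)] u(2) g(2) by blast
    then show ?thesis using g by (metis injD vec.linear_0)
  qed
  then have inj: "inj ?h" using vec.linear_inj_iff_eq_0[OF lin] by blast
  then obtain h' where h': "Vector_Spaces.linear (*s) (*s) h'" "\<And>x. h' (?h x) = x" "\<And>x. ?h (h' x) = x"
    using vec.linear_injective_isomorphism[OF lin inj refl] by blast
  \<comment> \<open>\<open>A j\<close> represents the map from block \<open>i\<close> to block
    \<open>j\<close>; \<open>matrix\<close> acts on columns, so it is transposed for rows.\<close>
  define A where "A j = transpose (matrix (\<lambda>x. block (g (h' x)) j))" for j
  have A: "x v* A j = block (g (h' x)) j" for x j
  proof -
    have "Vector_Spaces.linear (*s) (*s) (\<lambda>x. block (g (h' x)) j)"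
      using Vector_Spaces.linear_compose[OF h'(1) lin] by (simp add: o_def)
    then show ?thesis by (simp add: A_def matrix_works)
  qed
  have "row_space A = range (\<lambda>x. g (h' x))"
    by (simp add: row_space_def A)
  also have "\<dots> = g ` range h'" by (simp add: image_image)
  also have "range h' = UNIV" using h'(2) by (rule surjI)
  finally have "U = row_space A" using g by simp
  moreover have "A i = mat 1"
  proof -
    have "transpose (A i) *v x = transpose (mat 1) *v x" for x
      unfolding transpose_matrix_vector by (simp add: A h')
    then have "transpose (A i) = transpose (mat 1)" by (simp add: matrix_eq)
    then show ?thesis by (metis transpose_transpose)
  qed
  ultimately show ?thesis using that by blast
qed

text \<open>Normal form of the spread element through \<open>w\<close>: as \<open>A j\<close> is the
  identity, the parameter belonging to \<open>w\<close> is its own block \<open>j\<close>.\<close>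

lemma row_space_mem_cover:
  assumes "block w j \<noteq> 0"
  obtains A where "row_space A \<in> \<Sigma>" "A j = mat 1" "\<And>k. block w k = block w j v* A k"
proof -
  obtain U where U: "U \<in> \<Sigma>" "w \<in> U" by (rule covers)
  obtain A where A: "U = row_space A" "A j = mat 1"
    by (rule row_space_exists[OF U assms])
  obtain x where x: "w = block_vector (\<lambda>k. x v* A k)" using U A by (auto simp: row_space_def)
  then have "block w k = x v* A k" for k by simp
  moreover from this have "block w j = x" by (simp add: A)
  ultimately show ?thesis using that[of A] U A by simp
qed

text \<open>The identity block makes the common vector nonzero, so both spaces are the same spread
  element, and \<open>row_space_inj\<close> applies.\<close>

lemma row_space_eq:
  assumes "row_space A \<in> \<Sigma>" "row_space B \<in> \<Sigma>" "A i = mat 1" "B i = mat 1"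
    and "x \<noteq> 0" "\<And>k. x v* A k = x v* B k"
  shows "A = B"
proof -
  let ?v = "block_vector (\<lambda>k. x v* A k)"
  have "?v \<in> row_space A" by (auto simp: row_space_def)
  moreover have "?v \<in> row_space B" using assms(6) by (auto simp: row_space_def)
  moreover have "block ?v i \<noteq> 0" using assms(3,5) by simp
  then have "?v \<noteq> 0" by (metis block_zero)
  ultimately have "row_space A = row_space B" using unique assms(1,2) by blast
  then show ?thesis using row_space_inj assms by blast
qed

lemma row_space_drop_in:
  assumes "row_space A \<in> \<Sigma>" "A i = mat 1" "i \<noteq> j"
  shows "row_space (A(j := 0)) \<in> \<Sigma>"
proof -
  have "row_space A \<noteq> axis_space j"
  proof
    assume eq: "row_space A = axis_space j"
    obtain x :: "'a ^ 'n" where x: "x \<noteq> 0"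
      by (metis one_neq_zero)
    have "block_vector (\<lambda>k. x v* A k) \<in> axis_space j"
      by (simp flip: eq add: row_space_def)
    then have "x v* A i = 0" using assms(3) by (simp add: axis_space_def)
    then show False using x assms(2) by simp
  qed
  then show ?thesis using drop_block_in[OF assms(1)] by (simp add: row_space_drop)
qed

lemma row_space_restrict:
  assumes "row_space A \<in> \<Sigma>" "A i = mat 1" "finite K" "i \<notin> K"
  shows "row_space (\<lambda>k. if k \<in> K then 0 else A k) \<in> \<Sigma>"
  using assms(3,4)
proof (induction K)
  case empty
  then show ?case using assms by simp
next
  case (insert j K)
  have "(\<lambda>k. if k \<in> insert j K then 0 else A k) = (\<lambda>k. if k \<in> K then 0 else A k)(j := 0)"
    by auto
  then show ?case
    using row_space_drop_in[of "\<lambda>k. if k \<in> K then 0 else A k" i j] insert assms(2) by auto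
qed

text \<open>The sets \<open>M\<^sub>i\<^sub>j\<close>, defined by elements supported on two blocks;
  \<open>entriesI\<close> shows that matrices from larger elements belong to them too. For
  \<open>i = j\<close> the second update overwrites the first, so the meaning is the intended one
  only for distinct indices.\<close>

definition entries :: "'r \<Rightarrow> 'r \<Rightarrow> ('a ^ 'n ^ 'n) set" where
  "entries i j = {A. row_space ((\<lambda>_. 0)(i := mat 1, j := A)) \<in> \<Sigma>}"

lemma entriesI:
  assumes "row_space A \<in> \<Sigma>" "A i = mat 1" "i \<noteq> j"
  shows "A j \<in> entries i j"
proof -
  have "(\<lambda>k. if k \<in> - {i, j} then 0 else A k) = (\<lambda>_. 0)(i := mat 1, j := A j)"
    using assms(2) by auto
  then show ?thesis
    using row_space_restrict[OF assms(1,2), of "- {i, j}"] by (simp add: entries_def)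
qed

lemma zero_in_entries: "i \<noteq> j \<Longrightarrow> 0 \<in> entries i j"
  using entriesI[of "\<lambda>j. if j = i then mat 1 else 0" i j] axis_in[of i] by (simp add: row_space_axis)

text \<open>The matrix comes from the spread element through the vector with \<open>x\<close> in
  block \<open>i\<close>, \<open>y\<close> in block \<open>j\<close> and zero elsewhere.\<close>

lemma entries_exists:
  assumes "i \<noteq> j" "x \<noteq> 0"
  obtains A where "A \<in> entries i j" "x v* A = y"
proof -
  let ?w = "block_vector ((\<lambda>_. 0)(i := x, j := y))"
  have "block ?w i \<noteq> 0" using assms by simp
  then obtain A
    where A: "row_space A \<in> \<Sigma>" "A i = mat 1" "\<And>k. block ?w k = block ?w i v* A k"
    using row_space_mem_cover by blast
  have "y = x v* A j" using A(3)[of j] assms by simp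
  then show ?thesis using that entriesI[OF A(1,2) assms(1)] by simp
qed

lemma entries_unique:
  assumes "i \<noteq> j" "x \<noteq> 0" "A \<in> entries i j" "B \<in> entries i j" "x v* A = x v* B"
  shows "A = B"
proof -
  have "(\<lambda>_. 0)(i := mat 1, j := A) = (\<lambda>_. 0)(i := mat 1, j := B)"
    by (rule row_space_eq[of _ _ i x]) (use assms in \<open>auto simp: entries_def\<close>)
  then show ?thesis by (metis fun_upd_same)
qed

text \<open>Distinct entries agree on no nonzero row vector, so their difference has trivial
  kernel.\<close>

lemma entries_diff_invertible:
  assumes "i \<noteq> j" "A \<in> entries i j" "B \<in> entries i j" "A \<noteq> B"
  shows "invertible (A - B)"
proof -
  have "x = 0" if "x v* (A - B) = 0" for x
    using that entries_unique[OF assms(1) _ assms(2,3), of x] assms(4)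
    by (auto simp: vector_matrix_mult_diff_rdistrib)
  then have "\<forall>x. transpose (A - B) *v x = 0 \<longrightarrow> x = 0" by simp
  then show ?thesis
    by (simp only: invertible_right_inverse matrix_left_invertible_ker flip: left_invertible_transpose)
qed

text \<open>Take the spread element \<open>C\<close> through one vector of the desired space.
  Dropping its block \<open>i\<close> gives an element sharing a nonzero vector with
  \<open>A\<close>, hence \<open>A\<close> itself; its block \<open>i\<close> agrees with
  \<open>B\<close> on \<open>x\<close>, hence is \<open>B\<close>.\<close>

lemma row_space_extend:
  assumes A: "row_space A \<in> \<Sigma>" "A j = mat 1" "A i = 0" and B: "B \<in> entries j i" and ne: "j \<noteq> i"
  shows "row_space (A(i := B)) \<in> \<Sigma>"
proof -
  obtain x :: "'a ^ 'n" where x: "x \<noteq> 0"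
    by (metis one_neq_zero)
  let ?w = "block_vector (\<lambda>k. x v* (A(i := B)) k)"
  have wj: "block ?w j = x" using A ne by simp
  then have "block ?w j \<noteq> 0" using x by simp
  then obtain C
    where C: "row_space C \<in> \<Sigma>" "C j = mat 1" "\<And>k. block ?w k = block ?w j v* C k"
    using row_space_mem_cover by blast
  have xC: "x v* (A(i := B)) k = x v* C k" for k using C(3)[of k] unfolding wj by simp
  have "C(i := 0) = A"
  proof (rule row_space_eq[of _ _ j x])
    show "row_space (C(i := 0)) \<in> \<Sigma>" by (rule row_space_drop_in[OF C(1,2) ne])
    show "x v* (C(i := 0)) k = x v* A k" for k using xC[of k] A(3) by auto
  qed (use A C x ne in auto)
  moreover have "C i = B"
    by (rule entries_unique[OF ne x entriesI[OF C(1,2) ne] B]) (use xC[of i] in simp)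
  ultimately have "A(i := B) = C" by auto
  then show ?thesis using C by simp
qed

text \<open>Starting from axis \<open>i\<close>, the blocks are filled in one at a time by
  \<open>row_space_extend\<close>. So the blocks next to the identity can be chosen independently,
  and the sets \<open>entries i j\<close> determine the spread.\<close>

lemma row_space_in_iff:
  assumes "A i = mat 1"
  shows "row_space A \<in> \<Sigma> \<longleftrightarrow> (\<forall>j. j \<noteq> i \<longrightarrow> A j \<in> entries i j)"
proof
  assume "\<forall>j. j \<noteq> i \<longrightarrow> A j \<in> entries i j"
  then have A: "A j \<in> entries i j" if "j \<noteq> i" for j using that by blast
  have "row_space (\<lambda>k. if k \<in> K \<or> k = i then A k else 0) \<in> \<Sigma>" if "finite K" "i \<notin> K" for K
    using that
  proof (induction K)
    case empty
    have "(\<lambda>k. if k \<in> {} \<or> k = i then A k else 0) = (\<lambda>k. if k = i then mat 1 else 0)"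
      using assms by auto
    then show ?case using axis_in[of i] by (simp add: row_space_axis)
  next
    case (insert j K)
    let ?B = "\<lambda>k. if k \<in> K \<or> k = i then A k else 0"
    have "row_space (?B(j := A j)) \<in> \<Sigma>"
      using insert by (intro row_space_extend[of _ i]) (auto simp: assms intro: A)
    moreover have "(\<lambda>k. if k \<in> insert j K \<or> k = i then A k else 0) = ?B(j := A j)" by auto
    ultimately show ?case by simp
  qed
  from this[of "- {i}"] show "row_space A \<in> \<Sigma>" by simp
qed (use entriesI[of A i] assms in auto)

text \<open>Every matrix of the spread element through \<open>(x, ..., x)\<close> is invertible: a
  nonzero kernel vector would, by \<open>support\<close>, make a block of \<open>(x, ..., x)\<close>
  vanish. Multiplying block \<open>k\<close> on the right by the inverse of \<open>A k\<close>
  preserves the axes and turns this element into \<open>(I, ..., I)\<close>.\<close>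

lemma normalize_ones:
  obtains f :: "'a ^ ('r \<times> 'n) \<Rightarrow> 'a ^ ('r \<times> 'n)"
    where "Vector_Spaces.linear (*s) (*s) f" "bij f" "\<And>i. f ` axis_space i = axis_space i"
      "row_space (\<lambda>_. mat 1) \<in> image f ` \<Sigma>"
proof -
  obtain x :: "'a ^ 'n" where x: "x \<noteq> 0"
    by (metis one_neq_zero)
  let ?w = "block_vector (\<lambda>_ :: 'r. x)"
  fix j :: 'r
  have "block ?w j \<noteq> 0" using x by simp
  then obtain A where A: "row_space A \<in> \<Sigma>" "A j = mat 1" "\<And>k. block ?w k = block ?w j v* A k"
    using row_space_mem_cover by blast
  have w: "?w \<in> row_space A"
    unfolding row_space_def by (rule image_eqI[of _ _ x]) (use A(3) in \<open>simp_all add: block_eq_iff\<close>)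
  have "\<exists>C. C ** A k = mat 1 \<and> A k ** C = mat 1" for k
  proof -
    have "y = 0" if y: "y v* A k = 0" for y
    proof (rule ccontr)
      let ?v = "block_vector (\<lambda>l. y v* A l)"
      assume "y \<noteq> 0"
      then have "block ?v j \<noteq> 0" by (simp add: A)
      then have "?v \<noteq> 0" by (metis block_zero)
      moreover have "?v \<in> row_space A" by (simp add: row_space_def)
      ultimately have "block ?w k = 0" using support[OF A(1) _ _ _ w] y by simp
      then show False using x by simp
    qed
    then have "\<forall>y. transpose (A k) *v y = 0 \<longrightarrow> y = 0" by simp
    then have "invertible (A k)"
      by (simp only: invertible_right_inverse matrix_left_invertible_ker flip: left_invertible_transpose)
    then show ?thesis by (auto simp: invertible_def)
  qed
  then obtain C where C: "\<And>k. C k ** A k = mat 1" "\<And>k. A k ** C k = mat 1" by metis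
  define f g where "f v = block_vector (\<lambda>k. block v k v* C k)"
    and "g v = block_vector (\<lambda>k. block v k v* A k)" for v :: "'a ^ ('r \<times> 'n)"
  have fg: "f (g v) = v" "g (f v) = v" for v
    by (simp_all add: f_def g_def vector_matrix_mul_assoc C)
  show ?thesis
  proof (rule that)
    show "Vector_Spaces.linear (*s) (*s) f"
      by (rule linearI) (simp_all add: f_def block_eq_iff algebra_simps scalar_vector_matrix_assoc)
    show "bij f" using fg by (intro o_bij[of g]) (auto simp: o_def)
    show "f ` axis_space i = axis_space i" for i
    proof
      show "f ` axis_space i \<subseteq> axis_space i" by (auto simp: f_def axis_space_def)
      have "g v \<in> axis_space i" if "v \<in> axis_space i" for v
        using that by (auto simp: g_def axis_space_def)
      then show "axis_space i \<subseteq> f ` axis_space i" using fg(1) by (metis image_eqI subsetI)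
    qed
    have "row_space (\<lambda>_. mat 1) = f ` row_space A"
      by (simp add: row_space_def image_image f_def vector_matrix_mul_assoc C)
    then show "row_space (\<lambda>_. mat 1) \<in> image f ` \<Sigma>" using A(1) by blast
  qed
qed

end

section \<open>Spreads containing \<open>(I, ..., I)\<close>: all sets of entries coincide and form
  a nearfield spread set\<close>

locale unit_spread = axis_normal_spread \<Sigma>
  for \<Sigma> :: "('a::field ^ ('r::finite \<times> 'n::finite)) set set" +
  assumes ones: "row_space (\<lambda>_. mat 1) \<in> \<Sigma>"
    and card_index: "CARD('r) > 2"
begin

lemma one_in_entries: "i \<noteq> j \<Longrightarrow> mat 1 \<in> entries i j"
  using entriesI[OF ones] by simp

text \<open>This is how \<open>r > 2\<close> enters: comparing different sets of entries takes a
  third block.\<close>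

lemma third_index: obtains k :: 'r where "k \<noteq> i" "k \<noteq> j"
proof -
  have "card {i, j} \<le> 2" by (simp add: card_insert_if)
  then have "{i, j} \<noteq> UNIV" using card_index by (metis not_less)
  then show ?thesis using that by auto
qed

text \<open>Multiplying the spread element \<open>(I, A, B)\<close> on the left by \<open>C\<close>,
  the inverse of \<open>A\<close>, rewrites it as \<open>(C, I, C ** B)\<close>, now normalized at
  block \<open>j\<close>.\<close>

lemma entries_quotient:
  assumes "i \<noteq> j" "i \<noteq> k" "j \<noteq> k" "A \<in> entries i j" "B \<in> entries i k"
    and C: "C ** A = mat 1" "A ** C = mat 1"
  shows "C ** B \<in> entries j k"
proof -
  let ?D = "(\<lambda>_. 0)(i := mat 1, j := A, k := B)"
  have "row_space ?D \<in> \<Sigma>"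
    by (subst row_space_in_iff[of _ i]) (use assms zero_in_entries in auto)
  moreover have "invertible C" using C by (auto simp: invertible_def)
  ultimately have "row_space (\<lambda>l. C ** ?D l) \<in> \<Sigma>" by (simp only: row_space_scale)
  from entriesI[OF this, of j k] show ?thesis using assms by simp
qed

lemma entries_inverse:
  assumes "i \<noteq> j" "A \<in> entries i j" "A \<noteq> 0"
  obtains C where "C ** A = mat 1" "A ** C = mat 1"
  using entries_diff_invertible[OF assms(1,2) zero_in_entries assms(3)] assms(1)
  by (auto simp: invertible_def)

text \<open>The quotient by \<open>A = I\<close> changes the first index and keeps the
  matrix.\<close>

lemma entries_subset_left:
  assumes "i \<noteq> k" "j \<noteq> k"
  shows "entries i k \<subseteq> entries j k"
proof (cases "i = j")
  case False
  then show ?thesis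
    using entries_quotient[OF False assms one_in_entries[OF False], of _ "mat 1"] by auto
qed auto

text \<open>The quotient of \<open>I\<close> by \<open>A\<close> replaces a matrix by its inverse
  and frees the second index. Inverting twice, by way of an index \<open>l\<close> other than
  \<open>j\<close> and \<open>k\<close>, restores \<open>A\<close> with second index
  \<open>k\<close>.\<close>

lemma entries_subset_right:
  assumes "i \<noteq> j" "i \<noteq> k"
  shows "entries i j \<subseteq> entries i k"
proof (cases "j = k")
  case False
  have inv: "C \<in> entries i' k'"
    if "i' \<noteq> k'" "j' \<noteq> k'" "h \<noteq> j'" "A \<in> entries h j'" "C ** A = mat 1" "A ** C = mat 1"
    for h i' j' k' A C
  proof -
    \<comment> \<open>The quotient is taken in \<open>(I, A, I)\<close> with the identity at
      \<open>l\<close>, so \<open>l\<close> must avoid both \<open>j'\<close> and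
      \<open>k'\<close>.\<close>
    obtain l where l: "l \<noteq> j'" "l \<noteq> k'" by (rule third_index)
    have "A \<in> entries l j'" using entries_subset_left that l by blast
    then have "C \<in> entries j' k'"
      using entries_quotient[of l j' k' A "mat 1" C] that l one_in_entries by auto
    then show ?thesis using entries_subset_left that by blast
  qed
  obtain l where l: "l \<noteq> j" "l \<noteq> k" by (rule third_index)
  show ?thesis
  proof
    fix A assume A: "A \<in> entries i j"
    show "A \<in> entries i k"
    proof (cases "A = 0")
      case False
      obtain C where C: "C ** A = mat 1" "A ** C = mat 1"
        by (rule entries_inverse[OF assms(1) A False])
      have "C \<in> entries j l" using inv[of j l j i A C] A C l assms by auto
      then show ?thesis using inv[of i k l j C A] C l assms by auto
    qed (use zero_in_entries assms in auto)
  qed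
qed auto

text \<open>The first index is moved to some \<open>h\<close> distinct from \<open>j\<close> and
  \<open>l\<close>; then the second can pass from \<open>j\<close> to \<open>l\<close>, and finally
  the first from \<open>h\<close> to \<open>k\<close>.\<close>

lemma entries_eq:
  assumes "i \<noteq> j" "k \<noteq> l"
  shows "entries i j = entries k l"
proof -
  have "entries i j \<subseteq> entries k l" if ne: "i \<noteq> j" "k \<noteq> l" for i j k l
  proof -
    obtain h where "h \<noteq> j" "h \<noteq> l" by (rule third_index)
    then show ?thesis
      using entries_subset_left[of i j h] entries_subset_right[of h j l] entries_subset_left[of h l k] ne
      by blast
  qed
  then show ?thesis using assms by blast
qed

text \<open>The inverse \<open>C\<close> of \<open>A\<close> is again an entry, and dividing
  \<open>B\<close> by \<open>C\<close> yields \<open>A ** B\<close>.\<close>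

lemma entries_mult:
  assumes ij: "i \<noteq> j" and A: "A \<in> entries i j" and B: "B \<in> entries i j"
  shows "A ** B \<in> entries i j"
proof (cases "A = 0")
  case True
  then show ?thesis using zero_in_entries[OF ij] by simp
next
  case False
  obtain k where k: "k \<noteq> i" "k \<noteq> j" by (rule third_index)
  obtain C where C: "C ** A = mat 1" "A ** C = mat 1" by (rule entries_inverse[OF ij A False])
  have "C ** mat 1 \<in> entries j k"
    using entries_quotient[OF ij _ _ A one_in_entries C] k by auto
  then have "C \<in> entries i j" using entries_eq[of j k i j] k ij by auto
  moreover have "B \<in> entries i k" using entries_eq[of i j i k] k ij B by auto
  ultimately have "A ** B \<in> entries j k"
    using entries_quotient[of i j k C B A] C k ij by auto
  then show ?thesis using entries_eq[of j k i j] k ij by auto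
qed

text \<open>Evaluation at a fixed nonzero row vector is a bijection onto all row vectors, by
  \<open>entries_exists\<close> and \<open>entries_unique\<close>.\<close>

lemma card_entries:
  assumes "i \<noteq> j"
  shows "card (entries i j) = CARD('a ^ 'n)"
proof -
  obtain x :: "'a ^ 'n" where x: "x \<noteq> 0" by (metis one_neq_zero)
  have "bij_betw (\<lambda>A. x v* A) (entries i j) UNIV"
  proof (rule bij_betw_imageI)
    show "inj_on (\<lambda>A. x v* A) (entries i j)"
      using entries_unique[OF assms x] by (auto intro: inj_onI)
    have "y \<in> (\<lambda>A. x v* A) ` entries i j" for y
      using entries_exists[OF assms x, of y] by blast
    then show "(\<lambda>A. x v* A) ` entries i j = UNIV" by blast
  qed
  then show ?thesis by (rule bij_betw_same_card)
qed

end

section \<open>Transport of spreads and normality along linear bijections\<close>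

lemma vector_spread_image:
  fixes f :: "'a::field ^ 'm \<Rightarrow> 'a ^ 'k"
  assumes lin: "Vector_Spaces.linear (*s) (*s) f" and bij: "bij f" and \<Sigma>: "vector_spread d \<Sigma>"
  shows "vector_spread d (image f ` \<Sigma>)"
  unfolding vector_spread_def
proof (intro conjI ballI allI impI)
  fix W assume "W \<in> image f ` \<Sigma>"
  then obtain U where U: "W = f ` U" "vec.subspace U" "vec.dim U = d"
    using \<Sigma> by (auto simp: vector_spread_def)
  show "vec.subspace W" using vec.linear_subspace_image[OF lin] U by simp
  have "inj_on f (vec.span U)" using bij by (meson bij_is_inj inj_on_subset subset_UNIV)
  then show "vec.dim W = d" using vec.dim_image_eq[OF lin] U by simp
next
  fix v :: "'a ^ 'k" assume "v \<noteq> 0"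
  obtain w where w: "v = f w" using bij by (metis bij_is_surj surjD)
  have mem: "f w \<in> f ` U \<longleftrightarrow> w \<in> U" for U using bij by (simp add: bij_is_inj inj_image_mem_iff)
  have "w \<noteq> 0" using \<open>v \<noteq> 0\<close> w vec.linear_0[OF lin] by auto
  then have "\<exists>!U. U \<in> \<Sigma> \<and> w \<in> U" using \<Sigma> by (simp add: vector_spread_def)
  then show "\<exists>!W. W \<in> image f ` \<Sigma> \<and> v \<in> W"
    unfolding w using mem by (smt (verit, best) imageE imageI)
qed

lemma normal_subspace_image:
  fixes f :: "'a::field ^ 'm \<Rightarrow> 'a ^ 'k"
  assumes lin: "Vector_Spaces.linear (*s) (*s) f" and inj: "inj f" and E: "normal_subspace \<Sigma> E"
  shows "normal_subspace (image f ` \<Sigma>) (f ` E)"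
proof -
  have sp: "vec.span (f ` E \<union> f ` F) = f ` vec.span (E \<union> F)" for F
    by (simp add: vec.linear_span_image[OF lin] flip: image_Un)
  have zero: "f ` X \<subseteq> {0} \<longleftrightarrow> X \<subseteq> {0}" for X
    using inj_image_subset_iff[OF inj, of X "{0}"] vec.linear_0[OF lin] by simp
  show ?thesis
    using E unfolding normal_subspace_def
    by (simp add: sp zero inj_image_subset_iff[OF inj] flip: image_Int[OF inj])
qed

section \<open>Translation between point sets and vector subspaces\<close>

lemma pg_point_in_points_of:
  assumes "vec.subspace W" "v \<noteq> 0"
  shows "pg_point v \<in> points_of W \<longleftrightarrow> v \<in> W"
proof
  assume "pg_point v \<in> points_of W"
  then obtain w where "w \<in> W" "vec.span {v} = vec.span {w}"
    by (auto simp: points_of_def pg_point_def)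
  then have "v \<in> vec.span {w}" using vec.span_superset by blast
  also have "\<dots> \<subseteq> W" using \<open>w \<in> W\<close> assms(1) by (simp add: vec.span_minimal)
  finally show "v \<in> W" .
qed (use assms in \<open>auto simp: points_of_def\<close>)

lemma points_of_subset_iff:
  assumes "vec.subspace U" "vec.subspace W"
  shows "points_of U \<subseteq> points_of W \<longleftrightarrow> U \<subseteq> W"
proof
  assume sub: "points_of U \<subseteq> points_of W"
  show "U \<subseteq> W"
  proof
    fix v assume "v \<in> U"
    show "v \<in> W"
    proof (cases "v = 0")
      case False
      then have "pg_point v \<in> points_of W"
        using sub \<open>v \<in> U\<close> pg_point_in_points_of[OF assms(1)] by blast
      then show ?thesis using pg_point_in_points_of[OF assms(2) False] by simp
    qed (use assms vec.subspace_0 in auto)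
  qed
qed (auto simp: points_of_def)

lemma points_of_eq_iff:
  assumes "vec.subspace U" "vec.subspace W"
  shows "points_of U = points_of W \<longleftrightarrow> U = W"
  using points_of_subset_iff[OF assms] points_of_subset_iff[OF assms(2,1)] by blast

lemma points_of_image:
  fixes f :: "'a::field ^ 'm \<Rightarrow> 'a ^ 'k"
  assumes lin: "Vector_Spaces.linear (*s) (*s) f" and inj: "inj f"
  shows "points_of (f ` U) = image f ` points_of U"
proof -
  have "f v = 0 \<longleftrightarrow> v = 0" for v
    using injD[OF inj, of v 0] vec.linear_0[OF lin] by auto
  then have "f ` U - {0} = f ` (U - {0})" by auto
  moreover have "pg_point (f v) = f ` pg_point v" for v
    using vec.linear_span_image[OF lin, of "{v}"] by (simp add: pg_point_def)
  ultimately show ?thesis by (simp add: points_of_def image_image)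
qed

text \<open>Points are sets of vectors, and each nonzero vector of a subspace lies on one of its
  points, so both unions span the same space.\<close>

lemma pg_span_points_of:
  assumes "\<And>U. U \<in> X \<Longrightarrow> vec.subspace U"
  shows "pg_span (\<Union>(points_of ` X)) = points_of (vec.span (\<Union>X))"
proof -
  let ?Y = "\<Union>(\<Union>(points_of ` X))"
  have "pg_point v \<subseteq> U" if "U \<in> X" "v \<in> U" for U v
    using that assms by (simp add: pg_point_def vec.span_minimal)
  then have "?Y \<subseteq> \<Union>X" by (fastforce simp: points_of_def)
  moreover have "\<Union>X \<subseteq> vec.span ?Y"
  proof clarify
    fix v U assume U: "U \<in> X" "v \<in> U"
    show "v \<in> vec.span ?Y"
    proof (cases "v = 0")
      case False
      then have "pg_point v \<in> points_of U" using U by (auto simp: points_of_def)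
      moreover have "v \<in> pg_point v" by (simp add: pg_point_def vec.span_base)
      ultimately have "v \<in> ?Y" using U by blast
      then show ?thesis by (rule vec.span_base)
    qed (simp add: vec.span_zero)
  qed
  ultimately have "vec.span ?Y = vec.span (\<Union>X)"
    by (meson subset_antisym vec.span_minimal vec.span_mono vec.subspace_span)
  then show ?thesis by (simp add: pg_span_def)
qed

text \<open>The dimension in \<open>is_spread\<close> is projective, hence \<open>d + 1\<close>.
  Uniqueness of the subspace through a vector rests on \<open>points_of\<close> being injective on
  subspaces.\<close>

lemma is_spread_vector_spread:
  assumes "is_spread d S"
  obtains \<Sigma> where "vector_spread (d + 1) \<Sigma>" "S = points_of ` \<Sigma>"
proof
  let ?\<Sigma> = "{U. vec.subspace U \<and> vec.dim U = d + 1 \<and> points_of U \<in> S}"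
  show "S = points_of ` ?\<Sigma>"
    using assms by (auto simp: is_spread_def pg_subspaces_def)
  have part: "partition_on pg_points S" using assms by (simp add: is_spread_def)
  show "vector_spread (d + 1) ?\<Sigma>"
    unfolding vector_spread_def
  proof (intro conjI ballI allI impI)
    fix v :: "'a ^ 'b" assume v: "v \<noteq> 0"
    then have "pg_point v \<in> \<Union>S"
      using partition_onD1[OF part] by (auto simp: pg_points_def points_of_def)
    then obtain P where P: "P \<in> S" "pg_point v \<in> P" by blast
    then obtain U where U: "P = points_of U" "vec.subspace U" "vec.dim U = d + 1"
      using assms by (auto simp: is_spread_def pg_subspaces_def)
    show "\<exists>!U. U \<in> ?\<Sigma> \<and> v \<in> U"
    proof
      show "U \<in> ?\<Sigma> \<and> v \<in> U" using U P pg_point_in_points_of[OF U(2) v] by simp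
      fix W assume W: "W \<in> ?\<Sigma> \<and> v \<in> W"
      then have "pg_point v \<in> points_of W" using v by (auto simp: points_of_def)
      then have "points_of W = P"
        using partition_onD2[OF part] P W by (auto simp: disjoint_def)
      then show "W = U" using points_of_eq_iff W U by auto
    qed
  qed auto
qed

text \<open>The point of a nonzero \<open>w\<close> in \<open>U\<close> and the span lies in some
  part of the partition. That part comes from a spread element containing \<open>w\<close>, so it
  comes from \<open>U\<close>.\<close>

lemma normal_element_normal_subspace:
  assumes \<Sigma>: "vector_spread d \<Sigma>" and E: "E \<in> \<Sigma>" and normal: "normal_element (points_of ` \<Sigma>) (points_of E)"
  shows "normal_subspace \<Sigma> E"
  unfolding normal_subspace_def
proof (intro conjI ballI E)
  have sub: "vec.subspace U" if "U \<in> \<Sigma>" for U using \<Sigma> that by (simp add: vector_spread_def)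
  have uniq: "U = W" if "U \<in> \<Sigma>" "W \<in> \<Sigma>" "w \<in> U" "w \<in> W" "w \<noteq> 0" for U W w
    using \<Sigma> that by (auto simp: vector_spread_def)
  fix F U assume F: "F \<in> \<Sigma>" and U: "U \<in> \<Sigma>"
  have "U \<subseteq> vec.span (E \<union> F)" if w: "w \<in> U" "w \<in> vec.span (E \<union> F)" "w \<noteq> 0" for w
  proof (cases "F = E")
    \<comment> \<open>\<open>normal_element\<close> does not speak about \<open>F = E\<close>; here
      the span is just \<open>E\<close>.\<close>
    case True
    then have "w \<in> E" using w sub[OF E] by (simp add: vec.span_eq_iff[THEN iffD2])
    then have "U = E" using uniq[OF U E w(1)] w(3) by simp
    then show ?thesis using vec.span_superset[of "E \<union> F"] by auto
  next
    case False
    then have "points_of F \<noteq> points_of E" using points_of_eq_iff[OF sub[OF F] sub[OF E]] by simp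
    moreover have "points_of F \<in> points_of ` \<Sigma>" using F by (rule imageI)
    ultimately obtain T where T: "T \<subseteq> points_of ` \<Sigma>" "partition_on (pg_span (points_of E \<union> points_of F)) T"
      using normal unfolding normal_element_def by blast
    have "pg_span (points_of E \<union> points_of F) = points_of (vec.span (E \<union> F))"
      using pg_span_points_of[of "{E, F}"] sub E F by auto
    then have union: "\<Union>T = points_of (vec.span (E \<union> F))" using partition_onD1[OF T(2)] by simp
    have "pg_point w \<in> points_of (vec.span (E \<union> F))"
      by (simp only: pg_point_in_points_of[OF vec.subspace_span w(3)] w)
    then obtain P where P: "P \<in> T" "pg_point w \<in> P" using union by blast
    then obtain W where W: "W \<in> \<Sigma>" "P = points_of W" using T by auto
    then have "w \<in> W" using pg_point_in_points_of[OF sub[OF W(1)] w(3)] P by simp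
    then have "W = U" using uniq[OF W(1) U _ w(1,3)] by simp
    then have "points_of U \<subseteq> points_of (vec.span (E \<union> F))" using union P W by blast
    then show ?thesis using points_of_subset_iff[OF sub[OF U] vec.subspace_span] by simp
  qed
  then show "U \<inter> vec.span (E \<union> F) \<subseteq> {0} \<or> U \<subseteq> vec.span (E \<union> F)" by blast
qed

section \<open>Collineations from linear maps, and coordinates adapted to the normal
  elements\<close>

lemma inj_image: "inj f \<Longrightarrow> inj (image f)"
  by (simp add: inj_def inj_image_eq_iff)

text \<open>Lines are subspaces of vector dimension \<open>1 + 1\<close>, which linear bijections
  preserve; the inverse map shows that every line is reached.\<close>

lemma collineation_linear:
  fixes f :: "'a::field ^ 'm \<Rightarrow> 'a ^ 'm"
  assumes lin: "Vector_Spaces.linear (*s) (*s) f" and bij: "bij f"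
  shows "collineation (image f)"
proof -
  have inj: "inj f" using bij by (rule bij_is_inj)
  obtain g where g: "Vector_Spaces.linear (*s) (*s) g" "\<And>x. g (f x) = x" "\<And>x. f (g x) = x"
    using vec.linear_injective_isomorphism[OF lin inj refl] by blast
  have "inj g" using g(3) by (metis injI)
  have dim: "vec.dim (h ` U) = vec.dim U"
    if "Vector_Spaces.linear (*s) (*s) h" "inj h" for h :: "'a ^ 'm \<Rightarrow> 'a ^ 'm" and U
    using vec.dim_image_eq[OF that(1) inj_on_subset[OF that(2) subset_UNIV]] .
  have "image f ` pg_points = pg_points"
    using points_of_image[OF lin inj, of UNIV] bij by (simp add: pg_points_def bij_is_surj)
  moreover have "image (image f) ` pg_subspaces 1 = pg_subspaces 1"
  proof
    have "image f ` points_of U \<in> pg_subspaces 1" if "vec.subspace U" "vec.dim U = 1 + 1" for U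
      unfolding points_of_image[OF lin inj, symmetric] pg_subspaces_def
      using that vec.linear_subspace_image[OF lin, of U] dim[OF lin inj, of U] by auto
    then show "image (image f) ` pg_subspaces 1 \<subseteq> pg_subspaces 1"
      by (auto simp: pg_subspaces_def)
    have "points_of U \<in> image (image f) ` pg_subspaces 1" if "vec.subspace U" "vec.dim U = 1 + 1" for U
    proof (rule image_eqI)
      have "U = f ` (g ` U)" by (simp add: image_image g)
      then show "points_of U = image f ` points_of (g ` U)"
        by (metis points_of_image[OF lin inj])
      show "points_of (g ` U) \<in> pg_subspaces 1"
        unfolding pg_subspaces_def
        using that vec.linear_subspace_image[OF g(1), of U] dim[OF g(1) \<open>inj g\<close>, of U] by auto
    qed
    then show "pg_subspaces 1 \<subseteq> image (image f) ` pg_subspaces 1"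
      by (auto simp: pg_subspaces_def)
  qed
  moreover have "inj (image f)" using inj by (rule inj_image)
  moreover from this have "inj (image (image f))" by (rule inj_image)
  ultimately show ?thesis
    unfolding collineation_def bij_betw_def by (meson inj_on_subset subset_UNIV)
qed

text \<open>Adding up parametrizations of the \<open>E i\<close> gives an endomorphism
  \<open>h\<close> that maps axis \<open>i\<close> onto \<open>E i\<close>. It is surjective because
  the \<open>E i\<close> span, hence injective by finite dimension, and \<open>f\<close> is its
  inverse.\<close>

lemma axis_coordinates:
  fixes E :: "'r \<Rightarrow> ('a::field ^ ('r::finite \<times> 'n::finite)) set"
  assumes sub: "\<And>i. vec.subspace (E i)" and dim: "\<And>i. vec.dim (E i) = CARD('n)"
    and spans: "vec.span (\<Union>i. E i) = UNIV"
  obtains f :: "'a ^ ('r \<times> 'n) \<Rightarrow> 'a ^ ('r \<times> 'n)"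
    where "Vector_Spaces.linear (*s) (*s) f" "bij f" "\<And>i. f ` E i = axis_space i"
proof -
  have "\<exists>g :: 'a ^ 'n \<Rightarrow> 'a ^ ('r \<times> 'n). Vector_Spaces.linear (*s) (*s) g \<and> g ` UNIV = E i \<and> inj_on g UNIV" for i
    by (rule vec.subspace_isomorphism[OF vec.subspace_UNIV sub]) (simp add: dim card_cart_basis)
  then obtain g :: "'r \<Rightarrow> 'a ^ 'n \<Rightarrow> 'a ^ ('r \<times> 'n)"
    where g: "\<And>i. Vector_Spaces.linear (*s) (*s) (g i)" "\<And>i. range (g i) = E i"
    by metis
  define h where "h v = (\<Sum>i\<in>UNIV. g i (block v i))" for v
  have "Vector_Spaces.linear (*s) (*s) (\<lambda>v. g i (block v i))" for i
    using Vector_Spaces.linear_compose[OF linear_block g(1)] by (simp add: o_def)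
  then have lin: "Vector_Spaces.linear (*s) (*s) h"
    unfolding h_def by (intro vec.linear_compose_sum) simp
  have h_axis: "h v = g i (block v i)" if "v \<in> axis_space i" for v i
  proof -
    have "h v = (\<Sum>j\<in>UNIV. if j = i then g i (block v i) else 0)"
      unfolding h_def using that vec.linear_0[OF g(1)]
      by (intro sum.cong) (auto simp: axis_space_def)
    then show ?thesis by simp
  qed
  have img: "h ` axis_space i = E i" for i
  proof -
    have "h ` axis_space i = (\<lambda>v. g i (block v i)) ` axis_space i" 
      using h_axis by (intro image_cong) auto
    also have "\<dots> = g i ` ((\<lambda>v. block v i) ` axis_space i)" by (simp add: image_image)
    also have "(\<lambda>v. block v i) ` axis_space i = (UNIV :: ('a ^ 'n) set)"
    proof -
      have "x \<in> (\<lambda>v. block v i) ` axis_space i" for x :: "'a ^ 'n"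
        by (rule image_eqI[of _ _ "block_vector ((\<lambda>_. 0)(i := x))"]) (auto simp: axis_space_def)
      then show ?thesis by auto
    qed
    finally show ?thesis using g(2) by simp
  qed
  have "vec.span (\<Union>i. E i) \<subseteq> range h"
    using vec.linear_subspace_image[OF lin vec.subspace_UNIV] img by (intro vec.span_minimal) blast+
  then have "surj h" using spans by auto
  then have inj: "inj h" using vec.linear_surj_imp_inj lin by blast
  obtain f where f: "Vector_Spaces.linear (*s) (*s) f" "\<And>x. f (h x) = x" "\<And>x. h (f x) = x"
    using vec.linear_injective_isomorphism[OF lin inj refl] by blast
  show ?thesis
  proof (rule that)
    show "bij f" using f by (intro o_bij[of h]) (auto simp: o_def)
    show "f ` E i = axis_space i" for i by (simp add: f(2) image_image flip: img)
  qed (rule f(1))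
qed

section \<open>Identification with \<open>spread_of\<close> and conclusion\<close>

lemma matrix_space_row_space:
  assumes "A i = mat 1"
  shows "matrix_space A = points_of (row_space A)"
proof -
  let ?v = "\<lambda>x. block_vector (\<lambda>k. x v* A k)"
  have "?v x = 0 \<longleftrightarrow> x = 0" for x
  proof
    assume "?v x = 0"
    then have "block (?v x) i = 0" by simp
    then show "x = 0" using assms by simp
  qed (simp add: block_eq_iff)
  then have "range ?v - {0} = ?v ` (- {0})" by auto
  then show ?thesis by (auto simp: matrix_space_def points_of_def row_space_def)
qed

lemma nearfield_entries:
  fixes \<Sigma> :: "('a::{field,finite} ^ ('r::finite \<times> 'n::finite)) set set"
  assumes "unit_spread \<Sigma>" "i \<noteq> j"
  shows "nearfield_spread_set (axis_normal_spread.entries \<Sigma> i j)"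
proof -
  interpret unit_spread \<Sigma> by fact
  show ?thesis
    unfolding nearfield_spread_set_def spread_set_def
    using card_entries entries_diff_invertible zero_in_entries one_in_entries entries_mult assms(2)
    by simp
qed

text \<open>A spread element is normalized at the first nonzero block of one of its vectors; which
  pair of indices defines the entries does not matter by \<open>entries_eq\<close>. The converse is
  \<open>row_space_in_iff\<close> at the leading block.\<close>

lemma spread_of_entries:
  fixes \<Sigma> :: "('a::field ^ ('r::{finite,linorder} \<times> 'n::finite)) set set"
  assumes "unit_spread \<Sigma>" "i \<noteq> j"
  shows "points_of ` \<Sigma> = spread_of (axis_normal_spread.entries \<Sigma> i j)"
proof -
  interpret unit_spread \<Sigma> by fact
  let ?leading = "\<lambda>A k. A k \<noteq> 0 \<and> (\<forall>i<k. A i = 0)"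
  have first: "\<exists>k. P k \<and> (\<forall>i<k. \<not> P i)" if "P k" for P :: "'r \<Rightarrow> bool" and k
  proof -
    have "finite (Collect P)" "Collect P \<noteq> {}" using that by auto
    then show ?thesis
      using Min_in Min_le by (metis mem_Collect_eq not_le)
  qed
  have one: "mat 1 \<noteq> (0 :: 'a ^ 'n ^ 'n)"
    by (metis one_neq_zero vector_matrix_mul_rid vector_matrix_mult_0_right)
  show ?thesis
  proof (intro equalityI subsetI)
    fix P assume "P \<in> points_of ` \<Sigma>"
    then obtain U where U: "U \<in> \<Sigma>" "P = points_of U" by auto
    obtain u where u: "u \<in> U" "u \<noteq> 0" using has_nonzero[OF U(1)] .
    then obtain k where k: "block u k \<noteq> 0" "\<And>l. l < k \<Longrightarrow> block u l = 0"
      using first[of "\<lambda>k. block u k \<noteq> 0"] by (auto simp: block_eq_iff)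
    obtain A where A: "U = row_space A" "A k = mat 1" by (rule row_space_exists[OF U(1) u(1) k(1)])
    obtain x where x: "u = block_vector (\<lambda>l. x v* A l)" using u A by (auto simp: row_space_def)
    have "x \<noteq> 0" using k(1) x by auto
    have Al: "A l \<in> entries k l" if "k \<noteq> l" for l using entriesI that U A by blast
    \<comment> \<open>\<open>A l\<close> and \<open>0\<close> are both entries and agree on the
      nonzero vector \<open>x\<close>.\<close>
    have zero: "A l = 0" if "l < k" for l
    proof (rule entries_unique[OF _ \<open>x \<noteq> 0\<close> Al zero_in_entries])
      show "x v* A l = x v* 0" using k(2)[OF that] x by simp
    qed (use that in auto)
    have "A l \<in> entries i j" for l
    proof (cases "l = k")
      case True
      then show ?thesis using A one_in_entries[OF assms(2)] by simp
    next
      case False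
      then show ?thesis using Al[of l] entries_eq[of k l i j] assms(2) by auto
    qed
    moreover have "A l = mat 1" if "?leading A l" for l
    proof -
      have "\<not> l < k" "\<not> k < l" using that zero[of l] A(2) one by auto
      then show ?thesis using A(2) by (metis antisym_conv3)
    qed
    moreover have "A k \<noteq> 0" using A(2) one by simp
    moreover have "P = matrix_space A" using matrix_space_row_space[of A k] A U by simp
    ultimately show "P \<in> spread_of (entries i j)"
      unfolding spread_of_def by blast
  next
    fix P :: "('a ^ ('r \<times> 'n)) set set" assume "P \<in> spread_of (entries i j)"
    then obtain A :: "'r \<Rightarrow> 'a ^ 'n ^ 'n" where A: "P = matrix_space A" "\<And>l. A l \<in> entries i j"
      "\<exists>l. A l \<noteq> 0" "\<And>k. ?leading A k \<Longrightarrow> A k = mat 1"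
      unfolding spread_of_def by blast
    from A(3) obtain k where "?leading A k" using first[of "\<lambda>k. A k \<noteq> 0"] by auto
    then have k: "A k = mat 1" by (rule A(4))
    have "A l \<in> entries k l" if "l \<noteq> k" for l
      using A(2)[of l] entries_eq[of k l i j] that assms(2) by auto
    then have "row_space A \<in> \<Sigma>" using row_space_in_iff[of A k] k by blast
    then show "P \<in> points_of ` \<Sigma>" using matrix_space_row_space[of A k, OF k] A(1) by blast
  qed
qed

text \<open>Since \<open>N\<close> has exactly \<open>r\<close> elements,
  \<open>general_position\<close> with \<open>K = N\<close> says that they span; a bijection with
  the block indices numbers them.\<close>

lemma spread_frame:
  fixes \<Sigma> :: "('a::field ^ ('r::finite \<times> 'n::finite)) set set"
  assumes \<Sigma>: "vector_spread CARD('n) \<Sigma>"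
    and N: "\<And>E. E \<in> N \<Longrightarrow> normal_element (points_of ` \<Sigma>) E" "card N = CARD('r)" "general_position N"
  obtains e :: "'r \<Rightarrow> ('a ^ ('r \<times> 'n)) set"
    where "\<And>i. normal_subspace \<Sigma> (e i)" "vec.span (\<Union>i. e i) = UNIV"
proof -
  \<comment> \<open>Infinite sets have \<open>card\<close> equal to \<open>0\<close>, so a positive
    cardinality gives finiteness.\<close>
  have "finite N" using N(2) by (metis card.infinite zero_less_card_finite less_irrefl)
  then obtain p :: "'r \<Rightarrow> _" where p: "bij_betw p UNIV N"
    using N(2) using finite_same_card_bij[of "UNIV :: 'r set" N] by auto
  have p_in: "p i \<in> N" for i using bij_betwE[OF p] by simp
  then have "p i \<in> points_of ` \<Sigma>" for i using N(1) unfolding normal_element_def by blast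
  then have "\<exists>U\<in>\<Sigma>. p i = points_of U" for i by (simp add: image_iff)
  then obtain e where e: "\<And>i. e i \<in> \<Sigma>" "\<And>i. p i = points_of (e i)" by metis
  have "N = points_of ` range e" using bij_betw_imp_surj_on[OF p] e(2) by (simp add: image_image)
  moreover have sub: "vec.subspace U" if "U \<in> range e" for U
    using \<Sigma> e(1) that by (auto simp: vector_spread_def)
  ultimately have "points_of (vec.span (\<Union>i. e i)) = points_of UNIV"
    using N(2,3) pg_span_points_of[of "range e"] by (auto simp: general_position_def pg_points_def)
  then have "vec.span (\<Union>i. e i) = UNIV"
    by (rule iffD1[OF points_of_eq_iff[OF vec.subspace_span vec.subspace_UNIV]])
  moreover have "normal_subspace \<Sigma> (e i)" for i
  proof (rule normal_element_normal_subspace[OF \<Sigma> e(1)])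
    show "normal_element (points_of ` \<Sigma>) (points_of (e i))" using N(1)[OF p_in] e(2) by simp
  qed
  ultimately show ?thesis using that by blast
qed

theorem theorem3p1:
  fixes S :: "('a::{field,finite} ^ ('r::{finite,linorder} \<times> 'n::finite)) set set set"
  assumes "CARD('r) > 2"
    and "is_spread (CARD('n) - 1) S"
    and "\<exists>N. (\<forall>E\<in>N. normal_element S E) \<and> card N = CARD('r) \<and> general_position N"
  shows "\<exists>M :: ('a ^ 'n ^ 'n) set. nearfield_spread_set M \<and> projectively_equivalent S (spread_of M)"
proof -
  obtain N where N: "\<And>E. E \<in> N \<Longrightarrow> normal_element S E" "card N = CARD('r)" "general_position N"
    using assms(3) by blast
  \<comment> \<open>The truncated subtraction is harmless: \<open>CARD('n)\<close> is positive, so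
    \<open>CARD('n) - 1 + 1 = CARD('n)\<close>.\<close>
  obtain \<Sigma> where \<Sigma>: "vector_spread CARD('n) \<Sigma>" "S = points_of ` \<Sigma>"
    using is_spread_vector_spread[OF assms(2)] by auto
  obtain e :: "'r \<Rightarrow> ('a ^ ('r \<times> 'n)) set"
    where e: "\<And>i. normal_subspace \<Sigma> (e i)" "vec.span (\<Union>i. e i) = UNIV"
    using spread_frame[OF \<Sigma>(1) N[unfolded \<Sigma>(2)]] by blast
  have e_sub: "vec.subspace (e i)" "vec.dim (e i) = CARD('n)" for i
    using e(1) \<Sigma>(1) by (auto simp: normal_subspace_def vector_spread_def)
  obtain f :: "'a ^ ('r \<times> 'n) \<Rightarrow> 'a ^ ('r \<times> 'n)"
    where f: "Vector_Spaces.linear (*s) (*s) f" "bij f" "\<And>i. f ` e i = axis_space i"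
    using axis_coordinates[OF e_sub e(2)] by blast
  have "axis_normal_spread (image f ` \<Sigma>)"
    using vector_spread_image[OF f(1,2) \<Sigma>(1)] normal_subspace_image[OF f(1) bij_is_inj[OF f(2)] e(1)]
    by (simp add: axis_normal_spread_def f(3))
  then interpret axis_normal_spread "image f ` \<Sigma>" .
  obtain g :: "'a ^ ('r \<times> 'n) \<Rightarrow> 'a ^ ('r \<times> 'n)"
    where g: "Vector_Spaces.linear (*s) (*s) g" "bij g" "\<And>i. g ` axis_space i = axis_space i"
      "row_space (\<lambda>_. mat 1) \<in> image g ` image f ` \<Sigma>"
    using normalize_ones by blast
  let ?h = "g \<circ> f" and ?\<Sigma> = "image g ` image f ` \<Sigma>"
  have h: "Vector_Spaces.linear (*s) (*s) ?h" "bij ?h"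
    using Vector_Spaces.linear_compose[OF f(1) g(1)] bij_comp[OF f(2) g(2)] by simp_all
  have unit: "unit_spread ?\<Sigma>"
    using vector_spread_image[OF g(1,2) spread] g(4) assms(1)
      normal_subspace_image[OF g(1) bij_is_inj[OF g(2)] normal_axis]
    by (simp add: unit_spread_def axis_normal_spread_def unit_spread_axioms_def g(3))
  \<comment> \<open>Any two distinct indices serve, as all sets of entries are equal.\<close>
  have "card {i :: 'r} \<noteq> CARD('r)" for i using assms(1) by simp
  then obtain i j :: 'r where "i \<noteq> j" by (metis UNIV_eq_I singletonI)
  let ?M = "axis_normal_spread.entries ?\<Sigma> i j"
  have "image (image ?h) ` S = points_of ` ?\<Sigma>"
    using points_of_image[OF h(1) bij_is_inj[OF h(2)]]
    by (simp add: \<Sigma>(2) image_image image_comp)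
  also have "\<dots> = spread_of ?M" by (rule spread_of_entries[OF unit \<open>i \<noteq> j\<close>])
  finally have "projectively_equivalent S (spread_of ?M)"
    using collineation_linear[OF h] unfolding projectively_equivalent_def by blast
  then show ?thesis using nearfield_entries[OF unit \<open>i \<noteq> j\<close>] by blast
qed

end
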